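(* An empty $2020 \times 2020 \times 2020$ cube is given, and a $2020 \times 2020$ grid of square unit cells is drawn on each of its six faces. A beam is a $1 \times 1 \times 2020$ rectangular prism. Several beams are placed inside the cube subject to the following conditions: (i) The two $1 \times 1$ faces of each beam coincide with unit cells lying on opposite faces of the cube. (Hence, there are $3 \cdot 2020^2$ possible positions for a beam.) (ii) No two beams have intersecting interiors. (iii) The interiors of each of the four $1 \times 2020$ faces of each beam touch either a face of the cube or the interior of the face of another beam. What is the smallest positive number of beams that can be placed to satisfy these conditions? *)

theory Defs
  imports "HOL-Analysis.Analysis"
begin

text \<open>
  The big cube is \<open>[0,n]^3\<close>, with the grid lines of its faces at integer coordinates; the problem
  is the case \<open>n = 2020\<close>.  Faces of solids are facets in the sense of the library, and the interior
  of a face is its relative interior.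
\<close>

definition cube :: "nat \<Rightarrow> (real ^ 3) set" where
  "cube n = cbox 0 (\<chi> i. real n)"

definition level :: "3 \<Rightarrow> real \<Rightarrow> (real ^ 3) set" where
  "level d t = {x. x $ d = t}"

text \<open>The entry \<open>p d\<close> plays no role in the cell indexed by \<open>p\<close>.\<close>

definition unit_cells :: "nat \<Rightarrow> 3 \<Rightarrow> real \<Rightarrow> (real ^ 3) set set" where
  "unit_cells n d t =
    {C. \<exists>p :: 3 \<Rightarrow> nat. (\<forall>i. p i < n) \<and>
        C = {x \<in> level d t. \<forall>i. i \<noteq> d \<longrightarrow> real (p i) \<le> x $ i \<and> x $ i \<le> real (p i) + 1}}"

definition beam_along :: "nat \<Rightarrow> 3 \<Rightarrow> (real ^ 3) set \<Rightarrow> bool" where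
  "beam_along n d b \<longleftrightarrow>
    (\<exists>u v. (\<forall>i. v $ i - u $ i = (if i = d then real n else 1)) \<and> b = cbox u v \<and>
       b \<inter> level d (u $ d) \<in> unit_cells n d 0 \<and>
       b \<inter> level d (v $ d) \<in> unit_cells n d (real n))"

definition beams :: "nat \<Rightarrow> (real ^ 3) set set" where
  "beams n = {b. \<exists>d. beam_along n d b}"

text \<open>The four \<open>1 \<times> n\<close> faces of a beam with axis \<open>d\<close> are its facets not orthogonal to \<open>d\<close>.\<close>

definition long_face :: "nat \<Rightarrow> (real ^ 3) set \<Rightarrow> (real ^ 3) set \<Rightarrow> bool" where
  "long_face n b F \<longleftrightarrow> (\<exists>d. beam_along n d b \<and> F facet_of b \<and> \<not> (\<exists>t. F \<subseteq> level d t))"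

definition valid_placement :: "nat \<Rightarrow> (real ^ 3) set set \<Rightarrow> bool" where
  "valid_placement n S \<longleftrightarrow>
    finite S \<and> S \<subseteq> beams n \<and>
    (\<forall>b \<in> S. \<forall>b' \<in> S. b \<noteq> b' \<longrightarrow> interior b \<inter> interior b' = {}) \<and>
    (\<forall>b \<in> S. \<forall>F. long_face n b F \<longrightarrow>
       (\<exists>G. G facet_of cube n \<and> rel_interior F \<inter> G \<noteq> {}) \<or>
       (\<exists>b' \<in> S. b' \<noteq> b \<and> (\<exists>G. G facet_of b' \<and> rel_interior F \<inter> rel_interior G \<noteq> {})))"

end

(* Cut the cube into unit layers orthogonal to each axis e.  A long face orthogonal to e that lies
   inside the cube can only touch a beam whose axis is not e either and which lies in the adjacent
   layer, so one beam with axis other than e forces such a beam in every layer orthogonal to e.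
   If two axes occur, all 3n layers are occupied in this sense, and a beam accounts for only two of
   them: at least 3n/2 beams.  If a single axis occurs, contact preserves the remaining coordinate,
   and the beams fill the whole cube.  For even n, triples of pairwise touching beams placed along
   the diagonal attain 3n/2. *)

theory Submission
  imports Defs
begin

section \<open>Facets of boxes\<close>

lemma box_slice_face:
  fixes u v :: "real ^ 'n"
  assumes "w \<in> {u $ i, v $ i}"
  shows "{x \<in> cbox u v. x $ i = w} face_of cbox u v"
proof -
  have eq: "{x \<in> cbox u v. x $ i = w} = cbox u v \<inter> {x. axis i 1 \<bullet> x = w}"
    by (auto simp: inner_axis')
  from assms consider "w = u $ i" | "w = v $ i" by blast
  then show ?thesis
  proof cases
    case 1
    show ?thesis unfolding eq
      by (rule face_of_Int_supporting_hyperplane_ge)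
         (auto simp: inner_axis' mem_box_cart 1 convex_box)
  next
    case 2
    show ?thesis unfolding eq
      by (rule face_of_Int_supporting_hyperplane_le)
         (auto simp: inner_axis' mem_box_cart 2 convex_box)
  qed
qed

lemma box_slice_proper:
  fixes u v :: "real ^ 'n"
  assumes uv: "\<And>i. u $ i < v $ i"
  shows "{x \<in> cbox u v. x $ i = w} \<noteq> cbox u v"
proof
  assume "{x \<in> cbox u v. x $ i = w} = cbox u v"
  moreover have "u \<in> cbox u v" "v \<in> cbox u v"
    using uv by (auto simp: mem_box_cart less_imp_le)
  ultimately have "u $ i = w" "v $ i = w" by blast+
  with uv[of i] show False by simp
qed

text \<open>A facet of a polyhedron is cut out by a supporting hyperplane
  \<open>a \<bullet> x = b\<close>. If \<open>a $ i \<noteq> 0\<close>, every point of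
  \<open>F\<close> must already sit at the end of the i-th side favoured by the sign of
  \<open>a $ i\<close>, so \<open>F\<close> lies in one slice. That slice is a proper face, and
  \<open>F\<close> has codimension 1, so the two agree.\<close>

lemma facet_of_box_imp:
  fixes u v :: "real ^ 'n"
  assumes uv: "\<And>i. u $ i < v $ i" and F: "F facet_of cbox u v"
  obtains i w where "w \<in> {u $ i, v $ i}" "F = {x \<in> cbox u v. x $ i = w}"
proof -
  obtain a b where "a \<noteq> 0" and le: "cbox u v \<subseteq> {x. a \<bullet> x \<le> b}"
    and eq: "F = cbox u v \<inter> {x. a \<bullet> x = b}"
    using facet_of_polyhedron[OF _ F] by blast
  from \<open>a \<noteq> 0\<close> obtain i where i: "a $ i \<noteq> 0" by (auto simp: vec_eq_iff)
  define w where "w = (if a $ i > 0 then v $ i else u $ i)"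
  have w: "w \<in> {u $ i, v $ i}" by (simp add: w_def)
  let ?D = "{x \<in> cbox u v. x $ i = w}"
  have "F \<subseteq> ?D"
  proof
    fix x assume x: "x \<in> F"
    \<comment> \<open>Pushing \<open>x\<close> to the end \<open>w\<close> stays in the box and
      changes \<open>a \<bullet> x\<close> by \<open>a $ i * (w - x $ i)\<close>, which is
      nonnegative by the choice of \<open>w\<close>; maximality of \<open>b\<close> forces it to
      vanish.\<close>
    let ?y = "x + axis i (w - x $ i)"
    have xb: "x \<in> cbox u v" and ax: "a \<bullet> x = b" using x eq by auto
    have "?y \<in> cbox u v"
      using xb uv[of i] by (auto simp: mem_box_cart axis_def w_def less_imp_le)
    then have "a \<bullet> ?y \<le> b" using le by auto
    then have "a $ i * (w - x $ i) \<le> 0"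
      using ax by (simp add: inner_add_right inner_axis)
    moreover have "u $ i \<le> x $ i" "x $ i \<le> v $ i" using xb by (auto simp: mem_box_cart)
    ultimately have "x $ i = w"
      using i by (auto simp: w_def mult_le_0_iff split: if_splits)
    with xb show "x \<in> ?D" by simp
  qed
  have F': "F face_of ?D"
    using face_of_subset[OF facet_of_imp_face_of[OF F] \<open>F \<subseteq> ?D\<close>] by auto
  have D: "?D face_of cbox u v" by (rule box_slice_face[OF w])
  have "aff_dim ?D < aff_dim (cbox u v)"
    by (rule face_of_aff_dim_lt[OF convex_box(1) D box_slice_proper[OF uv]])
  moreover have "aff_dim F = aff_dim (cbox u v) - 1" using F by (simp add: facet_of_def)
  ultimately have "F = ?D"
    using face_of_aff_dim_lt[OF face_of_imp_convex[OF D] F'] by fastforce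
  with w that show ?thesis by blast
qed

text \<open>For the converse no dimension is computed: a slice is a nonempty proper face, hence
  contained in some facet, which is itself a slice by \<open>facet_of_box_imp\<close>. Two opposite
  corners of the first slice show that both slices are the same.\<close>

lemma facet_of_box:
  fixes u v :: "real ^ 'n"
  assumes uv: "\<And>i. u $ i < v $ i"
  shows "F facet_of cbox u v \<longleftrightarrow> (\<exists>i. \<exists>w \<in> {u $ i, v $ i}. F = {x \<in> cbox u v. x $ i = w})"
proof
  assume "F facet_of cbox u v"
  then show "\<exists>i. \<exists>w \<in> {u $ i, v $ i}. F = {x \<in> cbox u v. x $ i = w}"
    by (rule facet_of_box_imp[OF uv]) blast
next
  assume "\<exists>i. \<exists>w \<in> {u $ i, v $ i}. F = {x \<in> cbox u v. x $ i = w}"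
  then obtain i w where w: "w \<in> {u $ i, v $ i}" and F: "F = {x \<in> cbox u v. x $ i = w}" by blast
  \<comment> \<open>\<open>p\<close> and \<open>q\<close> are opposite corners of the slice: they
    differ in every coordinate except \<open>i\<close>, so they share a value only there.\<close>
  define p where "p = (\<chi> j. if j = i then w else u $ j)"
  define q where "q = (\<chi> j. if j = i then w else v $ j)"
  have pq: "p \<in> F" "q \<in> F"
    using uv w by (auto simp: F p_def q_def mem_box_cart less_imp_le)
  have "F face_of cbox u v" unfolding F by (rule box_slice_face[OF w])
  moreover have "F \<noteq> cbox u v" unfolding F by (rule box_slice_proper[OF uv])
  ultimately obtain G where G: "G facet_of cbox u v" "F \<subseteq> G"
    using face_of_polyhedron_subset_facet[of "cbox u v" F] pq by blast
  obtain j t where t: "t \<in> {u $ j, v $ j}" "G = {x \<in> cbox u v. x $ j = t}"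
    using facet_of_box_imp[OF uv G(1)] by blast
  have "p $ j = t" "q $ j = t" using pq G(2) t by auto
  with uv[of j] have "j = i" "t = w" by (auto simp: p_def q_def split: if_splits)
  with t F G show "F facet_of cbox u v" by simp
qed

text \<open>A point with some other coordinate at an end of its side lies on a proper face of the
  slice, and proper faces miss the relative interior. Conversely, the strict inequalities define an
  open set \<open>T\<close> whose part in the hyperplane \<open>x $ i = w\<close> lies in the
  slice.\<close>

lemma rel_interior_box_slice:
  fixes u v :: "real ^ 'n"
  assumes uv: "\<And>i. u $ i < v $ i" and w: "w \<in> {u $ i, v $ i}"
  shows "rel_interior {x \<in> cbox u v. x $ i = w} =
    {x. x $ i = w \<and> (\<forall>j. j \<noteq> i \<longrightarrow> u $ j < x $ j \<and> x $ j < v $ j)}"  (is "rel_interior ?D = ?R")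
proof (intro equalityI subsetI)
  fix x assume x: "x \<in> rel_interior ?D"
  then have xD: "x \<in> ?D" using rel_interior_subset by blast
  define p where "p = (\<chi> j. if j = i then w else u $ j)"
  define q where "q = (\<chi> j. if j = i then w else v $ j)"
  have pq: "p \<in> ?D" "q \<in> ?D"
    using uv w by (auto simp: p_def q_def mem_box_cart less_imp_le)
  have conv: "?D face_of cbox u v" by (rule box_slice_face[OF w])
  have "x $ j \<noteq> t" if "j \<noteq> i" and t: "t \<in> {u $ j, v $ j}" for j t
  proof
    assume "x $ j = t"
    let ?E = "?D \<inter> {x \<in> cbox u v. x $ j = t}"
    have "?E face_of ?D"
      by (rule face_of_subset[OF face_of_Int[OF conv box_slice_face[OF t]]]) auto
    moreover have "?E \<noteq> ?D"
    proof
      assume "?E = ?D"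
      then have "p $ j = t" "q $ j = t" using pq by blast+
      with uv[of j] \<open>j \<noteq> i\<close> show False by (auto simp: p_def q_def)
    qed
    ultimately have "?E \<inter> rel_interior ?D = {}" by (rule face_of_disjoint_rel_interior)
    with x xD \<open>x $ j = t\<close> show False by auto
  qed
  then show "x \<in> ?R"
    using xD by (fastforce simp: mem_box_cart order.order_iff_strict)
next
  fix x assume x: "x \<in> ?R"
  define T where "T = (\<Inter>j \<in> - {i}. {y :: real ^ 'n. u $ j < y $ j} \<inter> {y. y $ j < v $ j})"
  have "open T" unfolding T_def
    by (intro open_INT ballI open_Int open_halfspace_component_gt_cart
        open_halfspace_component_lt_cart) auto
  have "affine {y :: real ^ 'n. axis i 1 \<bullet> y = w}" by (rule affine_hyperplane)
  then have "affine hull ?D \<subseteq> {y. axis i 1 \<bullet> y = w}"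
    by (intro hull_minimal) (auto simp: inner_axis')
  then have hull: "affine hull ?D \<subseteq> {y. y $ i = w}" by (simp add: inner_axis')
  have "y \<in> ?D" if "y \<in> T" "y $ i = w" for y
  proof -
    have "u $ j \<le> y $ j \<and> y $ j \<le> v $ j" for j
    proof (cases "j = i")
      case True
      then show ?thesis using that w uv[of i] by (auto simp: less_imp_le)
    next
      case False
      then show ?thesis using that by (force simp: T_def)
    qed
    then show ?thesis using that by (simp add: mem_box_cart)
  qed
  moreover have "x \<in> T" "x $ i = w" using x by (auto simp: T_def)
  ultimately show "x \<in> rel_interior ?D"
    unfolding mem_rel_interior using \<open>open T\<close> hull by blast
qed

lemma box_Int_box_nonempty:
  fixes u v u' v' :: "real ^ 'n"
  shows "box u v \<inter> box u' v' \<noteq> {} \<longleftrightarrow> (\<forall>i. \<exists>t. u $ i < t \<and> t < v $ i \<and> u' $ i < t \<and> t < v' $ i)"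
proof
  assume "\<forall>i. \<exists>t. u $ i < t \<and> t < v $ i \<and> u' $ i < t \<and> t < v' $ i"
  then obtain x where "\<forall>i. u $ i < x i \<and> x i < v $ i \<and> u' $ i < x i \<and> x i < v' $ i"
    by metis
  then have "(\<chi> i. x i) \<in> box u v \<inter> box u' v'" by (simp add: mem_box_cart)
  then show "box u v \<inter> box u' v' \<noteq> {}" by blast
qed (force simp: mem_box_cart)


section \<open>Beams and contacts\<close>

definition lower :: "3 \<Rightarrow> (3 \<Rightarrow> nat) \<Rightarrow> real ^ 3" where
  "lower d p = (\<chi> i. if i = d then 0 else real (p i))"

definition upper :: "nat \<Rightarrow> 3 \<Rightarrow> (3 \<Rightarrow> nat) \<Rightarrow> real ^ 3" where
  "upper n d p = (\<chi> i. if i = d then real n else real (p i) + 1)"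

definition beam :: "nat \<Rightarrow> 3 \<Rightarrow> (3 \<Rightarrow> nat) \<Rightarrow> (real ^ 3) set" where
  "beam n d p = cbox (lower d p) (upper n d p)"

lemma lower_less_upper: "0 < n \<Longrightarrow> lower d p $ i < upper n d p $ i"
  by (simp add: lower_def upper_def)

lemma mem_beam:
  "x \<in> beam n d p \<longleftrightarrow>
    0 \<le> x $ d \<and> x $ d \<le> real n \<and> (\<forall>i. i \<noteq> d \<longrightarrow> real (p i) \<le> x $ i \<and> x $ i \<le> real (p i) + 1)"
  by (auto simp: beam_def mem_box_cart lower_def upper_def)

text \<open>The end cell at level 0 already determines the beam: it gives
  \<open>p i \<le> u $ i\<close> and \<open>v $ i \<le> p i + 1\<close>, and since the side has
  length 1 both are equalities.\<close>

lemma beam_along_iff: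
  assumes "0 < n"
  shows "beam_along n d b \<longleftrightarrow> (\<exists>p. (\<forall>i. p i < n) \<and> b = beam n d p)"
proof
  assume "beam_along n d b"
  then obtain u v where uv: "\<And>i. v $ i - u $ i = (if i = d then real n else 1)"
    and b: "b = cbox u v" and cell: "b \<inter> level d (u $ d) \<in> unit_cells n d 0"
    unfolding beam_along_def by blast
  from cell obtain p where p: "\<forall>i. p i < n" and eq: "b \<inter> level d (u $ d) =
      {x \<in> level d 0. \<forall>i. i \<noteq> d \<longrightarrow> real (p i) \<le> x $ i \<and> x $ i \<le> real (p i) + 1}"
    unfolding unit_cells_def by blast
  \<comment> \<open>The corner opposite to \<open>u\<close> in the end face; it carries the bounds
    on \<open>v\<close> into the cell.\<close>
  define q where "q = (\<chi> i. if i = d then u $ d else v $ i)"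
  have le: "u $ i \<le> v $ i" for i using uv[of i] by (auto split: if_splits)
  have "u \<in> b \<inter> level d (u $ d)" "q \<in> b \<inter> level d (u $ d)"
    using le by (auto simp: b q_def mem_box_cart level_def)
  then have u0: "u $ d = 0" and ul: "\<And>i. i \<noteq> d \<Longrightarrow> real (p i) \<le> u $ i"
    and vl: "\<And>i. i \<noteq> d \<Longrightarrow> v $ i \<le> real (p i) + 1"
    unfolding eq by (auto simp: level_def q_def)
  have "u $ i = lower d p $ i \<and> v $ i = upper n d p $ i" for i
    using uv[of i] u0 ul[of i] vl[of i] by (auto simp: lower_def upper_def)
  then have "u = lower d p" "v = upper n d p" by (simp_all add: vec_eq_iff)
  then have "b = beam n d p" unfolding b beam_def by simp
  with p show "\<exists>p. (\<forall>i. p i < n) \<and> b = beam n d p" by blast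
next
  assume "\<exists>p. (\<forall>i. p i < n) \<and> b = beam n d p"
  then obtain p where p: "\<forall>i. p i < n" and b: "b = beam n d p" by blast
  have "b \<inter> level d t \<in> unit_cells n d t" if "t \<in> {0, real n}" for t
    unfolding unit_cells_def using p that
    by (intro CollectI exI[of _ p]) (auto simp: b mem_beam level_def)
  moreover have "lower d p $ d = 0" "upper n d p $ d = real n"
    by (simp_all add: lower_def upper_def)
  ultimately show "beam_along n d b"
    unfolding beam_along_def
    by (intro exI[of _ "lower d p"] exI[of _ "upper n d p"])
       (auto simp: b beam_def lower_def upper_def)
qed

text \<open>The axis is recovered as the only direction in which the box is longer than 1. For
  \<open>n = 1\<close> this fails, as every beam is then the whole cube.\<close>

lemma beam_eqD:
  assumes n: "2 \<le> n" and eq: "beam n d p = beam n d' p'"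
  shows "d = d'" "i \<noteq> d \<Longrightarrow> p i = p' i"
proof -
  have "lower d p \<in> cbox (lower d p) (upper n d p)"
    by (simp add: mem_box_cart lower_def upper_def)
  then have "cbox (lower d p) (upper n d p) \<noteq> {}" by blast
  with eq have lu: "lower d p = lower d' p'" "upper n d p = upper n d' p'"
    unfolding beam_def eq_cbox by auto
  then have "lower d p $ d = lower d' p' $ d" "upper n d p $ d = upper n d' p' $ d" by simp_all
  with n show d: "d = d'" by (auto simp: lower_def upper_def split: if_splits)
  show "p i = p' i" if "i \<noteq> d"
    using arg_cong[OF lu(1), of "\<lambda>x. x $ i"] that d by (simp add: lower_def)
qed

text \<open>Coordinatewise: along an axis of either beam the interval \<open>(0, n)\<close> contains
  the unit interval of the other, while two open unit intervals with integer ends meet only if they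
  are equal.\<close>

lemma interior_beam_Int:
  assumes "\<forall>i. p i < n" "\<forall>i. p' i < n"
  shows "interior (beam n d p) \<inter> interior (beam n d' p') \<noteq> {} \<longleftrightarrow>
    (\<forall>i. i \<noteq> d \<longrightarrow> i \<noteq> d' \<longrightarrow> p i = p' i)"
proof -
  have "(\<exists>t. lower d p $ i < t \<and> t < upper n d p $ i \<and> lower d' p' $ i < t \<and> t < upper n d' p' $ i)
      \<longleftrightarrow> (i \<noteq> d \<longrightarrow> i \<noteq> d' \<longrightarrow> p i = p' i)" (is "?L \<longleftrightarrow> ?R") for i
  proof
    assume ?L
    then show ?R by (auto simp: lower_def upper_def)
  next
    assume R: ?R
    have "real (p i) + 1 \<le> real n" "real (p' i) + 1 \<le> real n"
      using assms by (metis Suc_leI of_nat_Suc of_nat_mono add.commute)+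
    then show ?L using R
      \<comment> \<open>The midpoint of the shorter of the two intervals.\<close>
      by (intro exI[of _ "if i = d then if i = d' then real n / 2 else real (p' i) + 1/2
            else real (p i) + 1/2"]) (auto simp: lower_def upper_def)
  qed
  then show ?thesis unfolding beam_def interior_cbox box_Int_box_nonempty by blast
qed

lemma long_face_beam:
  assumes n: "2 \<le> n" and p: "\<forall>i. p i < n"
  shows "long_face n (beam n d p) F \<longleftrightarrow>
    (\<exists>e w. e \<noteq> d \<and> w \<in> {p e, p e + 1} \<and> F = {x \<in> beam n d p. x $ e = real w})"
proof
  assume "long_face n (beam n d p) F"
  then obtain d' where d': "beam_along n d' (beam n d p)" and F: "F facet_of beam n d p"
    and nl: "\<not> (\<exists>t. F \<subseteq> level d' t)"
    unfolding long_face_def by blast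
  have n0: "0 < n" using n by simp
  obtain p' where "beam n d p = beam n d' p'"
    using d' unfolding beam_along_iff[OF n0] by blast
  then have [simp]: "d' = d" using beam_eqD(1)[OF n] by metis
  obtain e t where t: "t \<in> {lower d p $ e, upper n d p $ e}" "F = {x \<in> beam n d p. x $ e = t}"
    using F unfolding beam_def facet_of_box[OF lower_less_upper[OF n0]] by blast
  have "e \<noteq> d" using nl t by (auto simp: level_def)
  with t(1) have "t = real (p e) \<or> t = real (p e + 1)" by (auto simp: lower_def upper_def)
  then obtain w where "w \<in> {p e, p e + 1}" "t = real w" by blast
  with t(2) \<open>e \<noteq> d\<close> show "\<exists>e w. e \<noteq> d \<and> w \<in> {p e, p e + 1} \<and> F = {x \<in> beam n d p. x $ e = real w}"
    by (intro exI[of _ e] exI[of _ w] conjI) simp_all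
next
  assume "\<exists>e w. e \<noteq> d \<and> w \<in> {p e, p e + 1} \<and> F = {x \<in> beam n d p. x $ e = real w}"
  then obtain e w where e: "e \<noteq> d" and w: "w \<in> {p e, p e + 1}"
    and F: "F = {x \<in> beam n d p. x $ e = real w}" by blast
  have "real w \<in> {lower d p $ e, upper n d p $ e}" using e w by (auto simp: lower_def upper_def)
  then have "F facet_of beam n d p"
    using n F unfolding beam_def by (subst facet_of_box[OF lower_less_upper]) auto
  moreover have "\<not> F \<subseteq> level d t" for t
  proof
    assume sub: "F \<subseteq> level d t"
    \<comment> \<open>\<open>y 0\<close> and \<open>y n\<close> are the ends of a long edge of the
      face, so their d-th coordinates differ.\<close>
    define y where "y s = (\<chi> i. if i = d then s else if i = e then real w else real (p i))" for s
    have "y 0 \<in> F" "y (real n) \<in> F"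
      using e w by (auto simp: F mem_beam y_def)
    with sub have "y 0 $ d = t" "y (real n) $ d = t" by (auto simp: level_def)
    with n show False by (simp add: y_def)
  qed
  moreover have "beam_along n d (beam n d p)" using p n by (auto simp: beam_along_iff)
  ultimately show "long_face n (beam n d p) F" unfolding long_face_def by blast
qed

lemma rel_interior_beam_slice:
  assumes "0 < n" "w \<in> {lower d p $ e, upper n d p $ e}"
  shows "rel_interior {x \<in> beam n d p. x $ e = w} =
    {x. x $ e = w \<and> (\<forall>j. j \<noteq> e \<longrightarrow> lower d p $ j < x $ j \<and> x $ j < upper n d p $ j)}"
  using rel_interior_box_slice[OF lower_less_upper assms(2)] assms(1) by (simp add: beam_def)

lemma facet_of_cube:
  assumes "0 < n"
  shows "G facet_of cube n \<longleftrightarrow> (\<exists>i. \<exists>w \<in> {0, real n}. G = {x \<in> cube n. x $ i = w})"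
  using facet_of_box[of "0 :: real ^ 3" "\<chi> i. real n"] assms by (simp add: cube_def)

section \<open>Contacts across faces inside the cube\<close>

lemma valid_placementD:
  assumes "valid_placement n S"
  shows "finite S" "b \<in> S \<Longrightarrow> b \<in> beams n"
    and "\<lbrakk>b \<in> S; b' \<in> S; b \<noteq> b'\<rbrakk> \<Longrightarrow> interior b \<inter> interior b' = {}"
    and "\<lbrakk>b \<in> S; long_face n b F\<rbrakk> \<Longrightarrow>
      (\<exists>G. G facet_of cube n \<and> rel_interior F \<inter> G \<noteq> {}) \<or>
      (\<exists>b' \<in> S. b' \<noteq> b \<and> (\<exists>G. G facet_of b' \<and> rel_interior F \<inter> rel_interior G \<noteq> {}))"
  using assms unfolding valid_placement_def by (simp_all add: subset_iff)

lemma valid_placement_beamE: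
  assumes "valid_placement n S" "0 < n" "b \<in> S"
  obtains d p where "\<forall>i. p i < n" "b = beam n d p"
proof -
  from valid_placementD(2)[OF assms(1,3)] obtain d where "beam_along n d b"
    unfolding beams_def by blast
  with that show ?thesis unfolding beam_along_iff[OF assms(2)] by blast
qed

text \<open>A face at an inner level \<open>w\<close> has its relative interior strictly inside the
  cube, so it must touch a facet of another beam. Disjoint interiors give a coordinate
  \<open>k\<close>, axial for neither beam, in which the cells differ. A common relative interior
  point forces \<open>k\<close> and the direction \<open>j\<close> of the touching facet both to be
  \<open>e\<close>; all other coordinates that are axial for neither beam agree.\<close>

lemma neighbour:
  assumes S: "valid_placement n S" and n: "2 \<le> n"
    and p: "\<forall>i. p i < n" and b: "beam n d p \<in> S"
    and e: "e \<noteq> d" and w: "w \<in> {p e, p e + 1}" and wn: "0 < w" "w < n"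
  obtains d' p' where "\<forall>i. p' i < n" "beam n d' p' \<in> S" "d' \<noteq> e" "w \<in> {p' e, p' e + 1}"
    "p' e \<noteq> p e" "\<forall>i. i \<noteq> d \<longrightarrow> i \<noteq> d' \<longrightarrow> i \<noteq> e \<longrightarrow> p' i = p i"
proof -
  define F where "F = {x \<in> beam n d p. x $ e = real w}"
  have we: "real w \<in> {lower d p $ e, upper n d p $ e}" using e w by (auto simp: lower_def upper_def)
  have ri: "rel_interior F =
    {x. x $ e = real w \<and> (\<forall>j. j \<noteq> e \<longrightarrow> lower d p $ j < x $ j \<and> x $ j < upper n d p $ j)}"
    unfolding F_def using rel_interior_beam_slice[OF _ we] n by simp
  have "long_face n (beam n d p) F"
    unfolding long_face_beam[OF n p] F_def using e w by (intro exI[of _ e] exI[of _ w]) simp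
  note valid_placementD(4)[OF S b this]
  then consider G where "G facet_of cube n" "rel_interior F \<inter> G \<noteq> {}"
    | b' G where "b' \<in> S" "b' \<noteq> beam n d p" "G facet_of b'" "rel_interior F \<inter> rel_interior G \<noteq> {}"
    by (elim disjE exE bexE conjE)
  then show ?thesis
  proof cases
    case 1
    then obtain i x where x: "x \<in> rel_interior F" "x $ i \<in> {0, real n}"
      using n by (auto simp: facet_of_cube)
    have "0 \<le> lower d p $ i" "upper n d p $ i \<le> real n"
      using p[rule_format, of i] by (auto simp: lower_def upper_def)
    with x wn have False unfolding ri by (cases "i = e") force+
    then show ?thesis ..
  next
    case 2
    have n0: "0 < n" using n by simp
    obtain d' p' where p': "\<forall>i. p' i < n" and b': "b' = beam n d' p'"
      by (rule valid_placement_beamE[OF S n0 \<open>b' \<in> S\<close>])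
    have "interior (beam n d p) \<inter> interior b' = {}"
      by (rule valid_placementD(3)[OF S b]) (use 2 in simp_all)
    then obtain k where k: "k \<noteq> d" "k \<noteq> d'" "p k \<noteq> p' k"
      using interior_beam_Int[OF p p'] unfolding b' by blast
    obtain j t where t: "t \<in> {lower d' p' $ j, upper n d' p' $ j}" "G = {x \<in> b'. x $ j = t}"
      using 2(3) unfolding b' beam_def facet_of_box[OF lower_less_upper[OF n0]] by blast
    obtain x where x: "x \<in> rel_interior F" "x \<in> rel_interior G" using 2 by blast
    have xF: "x $ e = real w"
      "\<And>i. i \<noteq> e \<Longrightarrow> i \<noteq> d \<Longrightarrow> real (p i) < x $ i \<and> x $ i < real (p i) + 1"
      "\<And>i. i \<noteq> e \<Longrightarrow> i = d \<Longrightarrow> 0 < x $ i \<and> x $ i < real n"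
      using x(1) unfolding ri lower_def upper_def by auto
    have xG: "x $ j = t"
      "\<And>i. i \<noteq> j \<Longrightarrow> i \<noteq> d' \<Longrightarrow> real (p' i) < x $ i \<and> x $ i < real (p' i) + 1"
      using x(2) rel_interior_beam_slice[OF _ t(1)] n
      unfolding t(2) b' by (auto simp: lower_def upper_def)
    \<comment> \<open>Here \<open>x $ i\<close> lies strictly inside both unit intervals, whose ends
      are integers.\<close>
    have eq: "p' i = p i" if "i \<noteq> e" "i \<noteq> j" "i \<noteq> d" "i \<noteq> d'" for i
      using xF(2)[of i] xG(2)[of i] that by linarith
    have je: "j = e"
    proof (rule ccontr)
      assume "j \<noteq> e"
      \<comment> \<open>Either way one facet fixes \<open>x $ k\<close> at an integer, while the
        other beam confines it to an open unit interval between consecutive integers.\<close>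
      have "k = e \<or> k = j" using eq[of k] k by metis
      then show False
      proof
        assume "k = e"
        then show False using xG(2)[of k] xF(1) k \<open>j \<noteq> e\<close> by simp
      next
        assume "k = j"
        then show False using xF(2)[of k] xG(1) t(1) k \<open>j \<noteq> e\<close>
          by (auto simp: lower_def upper_def)
      qed
    qed
    then have "k = e" using eq[of k] k by metis
    have tw: "t = real w" using xG(1) xF(1) je by simp
    have "w \<in> {p' e, p' e + 1}"
      using t(1) k \<open>k = e\<close> by (auto simp: tw je lower_def upper_def)
    moreover have "\<forall>i. i \<noteq> d \<longrightarrow> i \<noteq> d' \<longrightarrow> i \<noteq> e \<longrightarrow> p' i = p i" using eq je by blast
    ultimately show ?thesis
      using that[OF p', of d'] 2(1) k \<open>k = e\<close> unfolding b' by metis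
  qed
qed

lemma neighbour_layer:
  assumes S: "valid_placement n S" and n: "2 \<le> n"
    and p: "\<forall>i. p i < n" and b: "beam n d p \<in> S"
    and e: "e \<noteq> d" and k: "k < n" "k = p e + 1 \<or> p e = k + 1"
  obtains d' p' where "\<forall>i. p' i < n" "beam n d' p' \<in> S" "d' \<noteq> e" "p' e = k"
    "\<forall>i. i \<noteq> d \<longrightarrow> i \<noteq> d' \<longrightarrow> i \<noteq> e \<longrightarrow> p' i = p i"
proof -
  \<comment> \<open>The plane separating the adjacent layers \<open>k\<close> and
    \<open>p e\<close>. The neighbour lies on one side of it, and not in layer \<open>p e\<close>,
    hence in layer \<open>k\<close>.\<close>
  define w where "w = max k (p e)"
  have "w \<in> {p e, p e + 1}" "0 < w" "w < n"
    using k p by (auto simp: w_def)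
  then obtain d' p' where *: "\<forall>i. p' i < n" "beam n d' p' \<in> S" "d' \<noteq> e" "w \<in> {p' e, p' e + 1}"
    "p' e \<noteq> p e" "\<forall>i. i \<noteq> d \<longrightarrow> i \<noteq> d' \<longrightarrow> i \<noteq> e \<longrightarrow> p' i = p i"
    by (rule neighbour[OF S n p b e])
  have "p' e = k" using *(4,5) k(2) by (auto simp: w_def)
  with * that show ?thesis by blast
qed

section \<open>Lower bound\<close>

text \<open>Induction upwards and downwards from \<open>a\<close>. It is applied both to the layers
  orthogonal to an axis and to a line of parallel beams.\<close>

lemma adjacent_closed_fills:
  fixes A :: "nat set"
  assumes "a \<in> A" "a < n"
    and step: "\<And>k l. k \<in> A \<Longrightarrow> l < n \<Longrightarrow> l = k + 1 \<or> k = l + 1 \<Longrightarrow> l \<in> A"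
  shows "{..<n} \<subseteq> A"
proof
  fix k assume "k \<in> {..<n}"
  then have "k < n" by simp
  show "k \<in> A"
  proof (cases "a \<le> k")
    case True
    then show ?thesis using \<open>k < n\<close>
      by (induction k rule: dec_induct) (use assms(1) step in auto)
  next
    case False
    then have "k \<le> a" by simp
    then show ?thesis
      by (induction k rule: inc_induct) (use assms in auto)
  qed
qed

section \<open>Occupied layers and double counting\<close>

lemma layer_nonempty:
  assumes S: "valid_placement n S" and n: "2 \<le> n"
    and p: "\<forall>i. p i < n" "beam n d p \<in> S" "d \<noteq> e" and k: "k < n"
  shows "\<exists>d' p'. (\<forall>i. p' i < n) \<and> beam n d' p' \<in> S \<and> d' \<noteq> e \<and> p' e = k"
proof -
  \<comment> \<open>The occupied layers. Since the neighbour supplied by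
    \<open>neighbour_layer\<close> again has an axis other than \<open>e\<close>, the argument can
    be repeated from it.\<close>
  define A where "A = {k. \<exists>d' p'. (\<forall>i. p' i < n) \<and> beam n d' p' \<in> S \<and> d' \<noteq> e \<and> p' e = k}"
  have "{..<n} \<subseteq> A"
  proof (rule adjacent_closed_fills)
    show "p e \<in> A" "p e < n" using p by (auto simp: A_def)
    fix k l assume "k \<in> A" and l: "l < n" "l = k + 1 \<or> k = l + 1"
    then obtain d' p' where q: "\<forall>i. p' i < n" "beam n d' p' \<in> S" "d' \<noteq> e" "p' e = k"
      unfolding A_def by blast
    have "l = p' e + 1 \<or> p' e = l + 1" using l q by simp
    from neighbour_layer[OF S n q(1,2) q(3)[symmetric] l(1) this]
    show "l \<in> A" unfolding A_def by blast
  qed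
  with k show ?thesis unfolding A_def by blast
qed

text \<open>Assumption \<open>dir\<close> says that at least two axes occur. Then each of the 3n
  pairs (direction, layer) is occupied, and a beam occupies at most two of them, one for each
  direction other than its axis.\<close>

lemma card_ge_layers:
  assumes S: "valid_placement n S" and n: "2 \<le> n"
    and dir: "\<And>e. \<exists>d p. (\<forall>i. p i < n) \<and> beam n d p \<in> S \<and> d \<noteq> e"
  shows "3 * n \<le> 2 * card S"
proof -
  \<comment> \<open>The layers, as pairs (normal direction, index), that contain the whole beam
    \<open>b\<close>.\<close>
  define R where "R b = {(e, k). \<exists>d p. (\<forall>i. p i < n) \<and> b = beam n d p \<and> d \<noteq> e \<and> p e = k}" for b
  have fin: "finite S" by (rule valid_placementD(1)[OF S])
  have R: "finite (R b) \<and> card (R b) \<le> 2" if bS: "b \<in> S" for b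
  proof -
    obtain d p where b: "b = beam n d p"
      using valid_placement_beamE[OF S _ bS] n by (metis less_le_trans pos2)
    have "R b \<subseteq> (\<lambda>e. (e, p e)) ` (UNIV - {d})"
    proof
      fix x assume "x \<in> R b"
      then obtain e d' p' where x: "x = (e, p' e)" "b = beam n d' p'" "d' \<noteq> e"
        unfolding R_def by blast
      with beam_eqD[OF n x(2)[unfolded b]] show "x \<in> (\<lambda>e. (e, p e)) ` (UNIV - {d})" by auto
    qed
    moreover have "card ((\<lambda>e. (e, p e)) ` (UNIV - {d})) \<le> 2"
      using card_image_le[of "UNIV - {d}" "\<lambda>e. (e, p e)"] by (simp add: card_Diff_singleton)
    ultimately show ?thesis
      by (meson card_mono finite finite_imageI finite_subset le_trans)
  qed
  have "(UNIV :: 3 set) \<times> {..<n} \<subseteq> (\<Union>b \<in> S. R b)"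
  proof
    fix x assume "x \<in> (UNIV :: 3 set) \<times> {..<n}"
    then obtain e k where x: "x = (e, k)" "k < n" by auto
    obtain d p where "\<forall>i. p i < n" "beam n d p \<in> S" "d \<noteq> e" using dir by blast
    from layer_nonempty[OF S n this x(2)] show "x \<in> (\<Union>b \<in> S. R b)"
      unfolding x R_def by blast
  qed
  then have "card ((UNIV :: 3 set) \<times> {..<n}) \<le> card (\<Union>b \<in> S. R b)"
    using fin R by (intro card_mono finite_UN_I) auto
  also have "\<dots> \<le> (\<Sum>b \<in> S. card (R b))" by (rule card_UN_le[OF fin])
  also have "\<dots> \<le> of_nat (card S) * 2" by (rule sum_bounded_above) (use R in auto)
  finally show ?thesis by (simp add: card_cartesian_product)
qed

section \<open>Placements with a single axis\<close>

lemma beam_cong: "(\<And>i. i \<noteq> d \<Longrightarrow> p i = q i) \<Longrightarrow> beam n d p = beam n d q"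
  by (auto simp: mem_beam)

text \<open>When the neighbour across a face orthogonal to \<open>e\<close> has the same axis
  \<open>d\<close>, the one coordinate other than \<open>d\<close> and \<open>e\<close> is
  preserved. The neighbour is thus the translate by one unit along \<open>e\<close>, and the whole
  line fills up.\<close>

lemma single_axis_line:
  assumes S: "valid_placement n S" and n: "2 \<le> n"
    and axis: "\<And>d' p. (\<forall>i. p i < n) \<Longrightarrow> beam n d' p \<in> S \<Longrightarrow> d' = d"
    and p: "\<forall>i. p i < n" "beam n d p \<in> S" and e: "e \<noteq> d" and k: "k < n"
  shows "beam n d (p(e := k)) \<in> S"
proof -
  have "{..<n} \<subseteq> {k. k < n \<and> beam n d (p(e := k)) \<in> S}"
  proof (rule adjacent_closed_fills)
    show "p e \<in> {k. k < n \<and> beam n d (p(e := k)) \<in> S}" "p e < n" using p by auto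
    fix k l assume "k \<in> {k. k < n \<and> beam n d (p(e := k)) \<in> S}"
      and l: "l < n" "l = k + 1 \<or> k = l + 1"
    then have q: "\<forall>i. (p(e := k)) i < n" "beam n d (p(e := k)) \<in> S" using p by auto
    have "l = (p(e := k)) e + 1 \<or> (p(e := k)) e = l + 1" using l by simp
    then obtain d' p' where p': "\<forall>i. p' i < n" "beam n d' p' \<in> S" "p' e = l"
      "\<forall>i. i \<noteq> d \<longrightarrow> i \<noteq> d' \<longrightarrow> i \<noteq> e \<longrightarrow> p' i = (p(e := k)) i"
      using neighbour_layer[OF S n q e l(1)] by metis
    have "d' = d" using axis p' by blast
    have "beam n d p' = beam n d (p(e := l))"
      by (rule beam_cong) (use p' \<open>d' = d\<close> in auto)
    with p' \<open>d' = d\<close> l show "l \<in> {k. k < n \<and> beam n d (p(e := k)) \<in> S}" by simp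
  qed
  with k show ?thesis by blast
qed

lemma axis_cases: "(e :: 3) \<noteq> d \<Longrightarrow> e = d + 1 \<or> e = d + 2"
  using exhaust_3[of d] exhaust_3[of e] by auto

lemma card_ge_single_axis:
  assumes S: "valid_placement n S" and n: "2 \<le> n" and "S \<noteq> {}"
    and axis: "\<And>d' p. (\<forall>i. p i < n) \<Longrightarrow> beam n d' p \<in> S \<Longrightarrow> d' = d"
  shows "n * n \<le> card S"
proof -
  obtain d' p where "\<forall>i. p i < n" "beam n d' p \<in> S"
    using \<open>S \<noteq> {}\<close> valid_placement_beamE[OF S] n by (metis all_not_in_conv less_le_trans pos2)
  with axis have p: "\<forall>i. p i < n" "beam n d p \<in> S" by blast+
  define h where "h = (\<lambda>(i, j). beam n d (p(d + 1 := i, d + 2 := j)))"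
  have "h ` ({..<n} \<times> {..<n}) \<subseteq> S"
  proof clarsimp
    fix i j assume ij: "i < n" "j < n"
    \<comment> \<open>First fill the line through \<open>p\<close> in direction
      \<open>d + 1\<close>, then from each of its beams the line in direction
      \<open>d + 2\<close>.\<close>
    have "beam n d (p(d + 1 := i)) \<in> S"
      by (rule single_axis_line[OF S n axis p _ ij(1)]) auto
    then show "h (i, j) \<in> S"
      unfolding h_def prod.case
      by (intro single_axis_line[OF S n axis _ _ _ ij(2)]) (use p ij in auto)
  qed
  moreover have "inj_on h ({..<n} \<times> {..<n})"
  proof (rule inj_onI, clarsimp)
    fix i j i' j' assume "h (i, j) = h (i', j')"
    then have eq: "beam n d (p(d + 1 := i, d + 2 := j)) = beam n d (p(d + 1 := i', d + 2 := j'))"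
      by (simp add: h_def)
    show "i = i' \<and> j = j'"
      using beam_eqD(2)[OF n eq, of "d + 1"] beam_eqD(2)[OF n eq, of "d + 2"] by simp
  qed
  ultimately have "card ({..<n} \<times> {..<n}) \<le> card S"
    using valid_placementD(1)[OF S] by (metis card_inj_on_le)
  then show ?thesis by simp
qed

lemma card_ge:
  assumes S: "valid_placement n S" and n: "2 \<le> n" and "S \<noteq> {}"
  shows "3 * n \<le> 2 * card S"
proof (cases "\<forall>e. \<exists>d p. (\<forall>i. p i < n) \<and> beam n d p \<in> S \<and> d \<noteq> e")
  case True
  then show ?thesis using card_ge_layers[OF S n] by blast
next
  case False
  \<comment> \<open>The failing direction is the common axis of all beams; the n * n beams then
    present exceed the bound, as \<open>2 * (n * n) \<ge> 4 * n\<close>.\<close>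
  then obtain d where "\<And>d' p. (\<forall>i. p i < n) \<Longrightarrow> beam n d' p \<in> S \<Longrightarrow> d' = d" by blast
  then have "n * n \<le> card S" by (rule card_ge_single_axis[OF assms])
  moreover have "2 * n \<le> n * n" using n by simp
  ultimately show ?thesis by linarith
qed

section \<open>Construction\<close>

text \<open>Both faces lie in the plane \<open>x $ e = w\<close>, as strips of width 1 running the
  full length of the cube in the perpendicular directions \<open>d\<close> and \<open>d'\<close>.
  Such strips always cross in a unit square.\<close>

lemma faces_touch:
  assumes p: "\<forall>i. p i < n" and p': "\<forall>i. p' i < n"
    and d: "d \<noteq> d'" "e \<noteq> d" "e \<noteq> d'"
    and w: "w \<in> {p e, p e + 1}" "w \<in> {p' e, p' e + 1}"
  shows "\<exists>G. G facet_of beam n d' p' \<and>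
    rel_interior {x \<in> beam n d p. x $ e = real w} \<inter> rel_interior G \<noteq> {}"
proof (intro exI conjI)
  have n0: "0 < n" using p[rule_format, of e] by simp
  have w1: "real w \<in> {lower d p $ e, upper n d p $ e}"
    and w2: "real w \<in> {lower d' p' $ e, upper n d' p' $ e}"
    using d w by (auto simp: lower_def upper_def)
  show "{x \<in> beam n d' p'. x $ e = real w} facet_of beam n d' p'"
    unfolding beam_def facet_of_box[OF lower_less_upper[OF n0]] using w2 by blast
  \<comment> \<open>The centre of the crossing square: its position along \<open>d\<close> comes
    from the second beam, that along \<open>d'\<close> from the first.\<close>
  define x where "x = (\<chi> i. if i = e then real w else if i = d then real (p' d) + 1/2
    else real (p i) + 1/2)"
  have other: "j = d \<or> j = d'" if "j \<noteq> e" for j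
    using that d exhaust_3[of d] exhaust_3[of d'] exhaust_3[of e] exhaust_3[of j] by auto
  have "real (p' d) + 1 \<le> real n" "real (p d') + 1 \<le> real n"
    using p p' by (metis Suc_leI of_nat_Suc of_nat_mono add.commute)+
  then have "x \<in> rel_interior {x \<in> beam n d p. x $ e = real w} \<inter>
      rel_interior {x \<in> beam n d' p'. x $ e = real w}"
    unfolding rel_interior_beam_slice[OF n0 w1] rel_interior_beam_slice[OF n0 w2]
    using d by (auto simp: x_def lower_def upper_def dest!: other)
  then show "rel_interior {x \<in> beam n d p. x $ e = real w} \<inter>
      rel_interior {x \<in> beam n d' p'. x $ e = real w} \<noteq> {}" by blast
qed

lemma boundary_face_touches:
  assumes p: "\<forall>i. p i < n" and e: "e \<noteq> d" and w: "w \<in> {p e, p e + 1}" "w = 0 \<or> w = n"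
  shows "\<exists>G. G facet_of cube n \<and> rel_interior {x \<in> beam n d p. x $ e = real w} \<inter> G \<noteq> {}"
proof (intro exI conjI)
  have n0: "0 < n" using p[rule_format, of e] by simp
  have w1: "real w \<in> {lower d p $ e, upper n d p $ e}"
    using e w by (auto simp: lower_def upper_def)
  show "{x \<in> cube n. x $ e = real w} facet_of cube n"
    unfolding facet_of_cube[OF n0] using w by (intro exI[of _ e]) auto
  \<comment> \<open>The centre of the long face.\<close>
  define x where "x = (\<chi> i. if i = e then real w else if i = d then real n / 2
    else real (p i) + 1/2)"
  have pn: "real (p i) + 1 \<le> real n" for i
    using p by (metis Suc_leI of_nat_Suc of_nat_mono add.commute)
  have "x \<in> rel_interior {x \<in> beam n d p. x $ e = real w}"
    unfolding rel_interior_beam_slice[OF n0 w1]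
    using n0 e by (auto simp: x_def lower_def upper_def)
  moreover have "0 \<le> x $ i \<and> x $ i \<le> real n" for i
    using pn[of i] w(2) by (auto simp: x_def)
  then have "x \<in> {x \<in> cube n. x $ e = real w}"
    by (simp add: cube_def mem_box_cart) (simp add: x_def)
  ultimately show "rel_interior {x \<in> beam n d p. x $ e = real w} \<inter>
      {x \<in> cube n. x $ e = real w} \<noteq> {}" by blast
qed

text \<open>Three mutually touching beams, one per axis, run through each of the \<open>2 \<times> 2 \<times> 2\<close> blocks
  \<open>[2k, 2k + 2]^3\<close> on the main diagonal.  Arithmetic on the index type \<open>3\<close> is modulo 3.\<close>

definition diag_pos :: "nat \<Rightarrow> 3 \<Rightarrow> 3 \<Rightarrow> nat" where
  "diag_pos k d i = (if i = d + 1 then 2 * k else 2 * k + 1)"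

definition diag_beams :: "nat \<Rightarrow> (real ^ 3) set set" where
  "diag_beams m = (\<lambda>(d, k). beam (2 * m) d (diag_pos k d)) ` (UNIV \<times> {..<m})"

lemma diag_pos_less: "k < m \<Longrightarrow> \<forall>i. diag_pos k d i < 2 * m"
  by (auto simp: diag_pos_def)

text \<open>Beams with the same axis differ in \<open>k\<close>, visible in direction
  \<open>d + 1\<close>. For different axes the third direction separates: one of the two positions
  there is even and the other odd, whatever the blocks are.\<close>

lemma diag_pos_separate:
  assumes "(d, k) \<noteq> (d', k')"
  obtains i where "i \<noteq> d" "i \<noteq> d'" "diag_pos k d i \<noteq> diag_pos k' d' i"
proof -
  have odd_even: "2 * a + 1 \<noteq> 2 * b" for a b :: nat by presburger
  consider "d' = d" "k \<noteq> k'" | "d' = d + 1" | "d = d' + 1"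
    using assms axis_cases[of d' d] by (cases "d' = d") auto
  then show ?thesis
  proof cases
    case 1
    then show ?thesis by (intro that[of "d + 1"]) (auto simp: diag_pos_def)
  next
    case 2
    then show ?thesis using odd_even by (intro that[of "d + 2"]) (auto simp: diag_pos_def)
  next
    case 3
    then show ?thesis using odd_even[of k' k]
      by (intro that[of "d' + 2"]) (auto simp: diag_pos_def)
  qed
qed

lemma card_diag_beams:
  assumes "1 \<le> m"
  shows "card (diag_beams m) = 3 * m"
proof -
  have "inj_on (\<lambda>(d, k). beam (2 * m) d (diag_pos k d)) (UNIV \<times> {..<m})"
  proof (rule inj_onI, clarify)
    fix d k d' k' assume eq: "beam (2 * m) d (diag_pos k d) = beam (2 * m) d' (diag_pos k' d')"
    have "2 \<le> 2 * m" using assms by simp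
    from beam_eqD[OF this eq] show "d = d' \<and> k = k'"
      by (metis diag_pos_separate prod.inject)
  qed
  then show ?thesis by (simp add: diag_beams_def card_image card_cartesian_product)
qed

text \<open>The touching beam has the third axis. A face in the middle plane of its block
  (\<open>w = 2 * k + 1\<close>) meets a beam of the same block; a face on the boundary of the block
  meets one of the previous block (\<open>w = 2 * k\<close>) or of the next
  (\<open>w = 2 * k + 2\<close>). The bounds on \<open>w\<close> ensure that this block
  exists.\<close>

lemma diag_neighbour:
  assumes "k < m" "e \<noteq> d" "w \<in> {diag_pos k d e, diag_pos k d e + 1}" "0 < w" "w < 2 * m"
  obtains d' k' where "k' < m" "d' \<noteq> d" "d' \<noteq> e" "w \<in> {diag_pos k' d' e, diag_pos k' d' e + 1}"
proof -
  consider "e = d + 1" "w = 2 * k" | "e = d + 1" "w = 2 * k + 1"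
    | "e = d + 2" "w = 2 * k + 1" | "e = d + 2" "w = 2 * k + 2"
    using assms(3) axis_cases[OF assms(2)] by (auto simp: diag_pos_def)
  then show ?thesis
  proof cases
    case 1
    then show ?thesis using assms
      by (intro that[of "k - 1" "d + 2"]) (auto simp: diag_pos_def)
  next
    case 2
    then show ?thesis using assms by (intro that[of k "d + 2"]) (auto simp: diag_pos_def)
  next
    case 3
    then show ?thesis using assms by (intro that[of k "d + 1"]) (auto simp: diag_pos_def)
  next
    case 4
    then show ?thesis using assms by (intro that[of "k + 1" "d + 1"]) (auto simp: diag_pos_def)
  qed
qed

lemma valid_diag_beams:
  assumes m: "1 \<le> m"
  shows "valid_placement (2 * m) (diag_beams m)"
proof -
  let ?n = "2 * m"
  have n: "2 \<le> ?n" "0 < ?n" using m by simp_all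
  have elim: "\<exists>d k. k < m \<and> b = beam ?n d (diag_pos k d)" if "b \<in> diag_beams m" for b
    using that by (auto simp: diag_beams_def)
  have "finite (diag_beams m)" by (simp add: diag_beams_def)
  moreover have "b \<in> beams ?n" if b: "b \<in> diag_beams m" for b
  proof -
    obtain d k where dk: "k < m" "b = beam ?n d (diag_pos k d)" using elim[OF b] by blast
    then have "beam_along ?n d b" unfolding beam_along_iff[OF n(2)] using diag_pos_less by blast
    then show ?thesis unfolding beams_def by blast
  qed
  moreover have "interior b \<inter> interior b' = {}"
    if b: "b \<in> diag_beams m" "b' \<in> diag_beams m" "b \<noteq> b'" for b b'
  proof -
    obtain d k where dk: "k < m" "b = beam ?n d (diag_pos k d)" using elim[OF b(1)] by blast
    obtain d' k' where dk': "k' < m" "b' = beam ?n d' (diag_pos k' d')" using elim[OF b(2)] by blast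
    have "(d, k) \<noteq> (d', k')" using b dk dk' by auto
    then obtain i where "i \<noteq> d" "i \<noteq> d'" "diag_pos k d i \<noteq> diag_pos k' d' i"
      by (rule diag_pos_separate)
    then show ?thesis
      using interior_beam_Int[OF diag_pos_less[OF dk(1)] diag_pos_less[OF dk'(1)]]
      unfolding dk dk' by blast
  qed
  moreover have "(\<exists>G. G facet_of cube ?n \<and> rel_interior F \<inter> G \<noteq> {}) \<or>
      (\<exists>b' \<in> diag_beams m. b' \<noteq> b \<and> (\<exists>G. G facet_of b' \<and> rel_interior F \<inter> rel_interior G \<noteq> {}))"
    if b: "b \<in> diag_beams m" and lf: "long_face ?n b F" for b F
  proof -
    obtain d k where dk: "k < m" "b = beam ?n d (diag_pos k d)" using elim[OF b] by blast
    note pos = diag_pos_less[OF dk(1), of d]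
    obtain e w where e: "e \<noteq> d" and w: "w \<in> {diag_pos k d e, diag_pos k d e + 1}"
      and F: "F = {x \<in> beam ?n d (diag_pos k d). x $ e = real w}"
      using lf unfolding dk(2) long_face_beam[OF n(1) pos] by blast
    show ?thesis
    \<comment> \<open>Faces on the boundary of the cube touch it; all others cross a face of the
      third-axis beam found by \<open>diag_neighbour\<close>.\<close>
    proof (cases "w = 0 \<or> w = ?n")
      case True
      then show ?thesis unfolding F by (rule disjI1[OF boundary_face_touches[OF pos e w]])
    next
      case False
      have "w \<le> ?n" using w pos[rule_format, of e] by auto
      with False have wn: "0 < w" "w < ?n" by auto
      obtain d' k' where dk': "k' < m" "d' \<noteq> d" "d' \<noteq> e"
        and w': "w \<in> {diag_pos k' d' e, diag_pos k' d' e + 1}"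
        by (rule diag_neighbour[OF dk(1) e w wn])
      let ?b' = "beam ?n d' (diag_pos k' d')"
      have "?b' \<in> diag_beams m" using dk' by (auto simp: diag_beams_def)
      moreover have "?b' \<noteq> b" using beam_eqD(1)[OF n(1)] dk dk' by metis
      moreover have "\<exists>G. G facet_of ?b' \<and> rel_interior F \<inter> rel_interior G \<noteq> {}"
        unfolding F
        by (rule faces_touch[OF pos diag_pos_less[OF dk'(1)] dk'(2)[symmetric] e dk'(3)[symmetric] w w'])
      ultimately show ?thesis by (intro disjI2 bexI[of _ ?b'] conjI)
    qed
  qed
  ultimately show ?thesis unfolding valid_placement_def by (intro conjI ballI allI impI subsetI)
qed

theorem mainTheorem2:
  "(\<exists>S. valid_placement 2020 S \<and> card S = 3030) \<and>
   (\<forall>S. valid_placement 2020 S \<and> 0 < card S \<longrightarrow> 3030 \<le> card S)"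
proof (intro conjI allI impI)
  show "\<exists>S. valid_placement 2020 S \<and> card S = 3030"
    \<comment> \<open>The diagonal of the cube of side 2020 carries 1010 blocks of side 2, with
      three beams each.\<close>
    using valid_diag_beams[of 1010] card_diag_beams[of 1010]
    by (intro exI[of _ "diag_beams 1010"]) simp
next
  fix S assume S: "valid_placement 2020 S \<and> 0 < card S"
  then have "3 * 2020 \<le> 2 * card S" by (intro card_ge) auto
  then show "3030 \<le> card S" by simp
qed

end
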